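(* Let $n\geq 6$ be an even integer. Let $\{a_i\}_{0\le i<n}$, $\{b_i\}_{0\le i<n}$, $\{c_i\}_{0\le i<n}$ be three decreasing (i.e. $a_0\ge a_1\ge\cdots\ge a_{n-1}$, and likewise for $b$ and $c$) sequences of real numbers in $[0,1]$, and let $A=\frac1n\sum_{i=0}^{n-1}a_i$, $B=\frac1n\sum_{i=0}^{n-1}b_i$, $C=\frac1n\sum_{i=0}^{n-1}c_i$ be their averages. Suppose that for all triples $(i,j,k)$ of integers with $0\le i,j,k<n$ and $i+j+k\geq n$ we have \[ a_ib_j+b_jc_k+c_ka_i\leq\frac{5}{8}(a_i+b_j+c_k). \] Then \[ AB+BC+CA\leq\frac{5}{8}(A+B+C). \] *)

theory Defs
  imports Complex_Main
begin

end

theory Submission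
  imports Defs
begin

text \<open>
  Put \<open>f(x,y,z) = xy + yz + zx - 5/8 (x + y + z)\<close>. Since \<open>f\<close> has no \<open>xyz\<close> term, summing
  \<open>f(a\<^sub>i, b\<^sub>j, c\<^sub>k)\<close> over the Latin square \<open>i + j + k \<equiv> 0 (mod n)\<close> gives exactly
  \<open>n\<^sup>2 f(A,B,C)\<close>, and the only triple of this square not covered by the hypothesis is \<open>(0,0,0)\<close>.
  The possibly positive value \<open>f(a\<^sub>0, b\<^sub>0, c\<^sub>0)\<close> is compensated by the triples with
  \<open>i + j + k = 2n\<close>: there even the points obtained by raising one coordinate to its maximum
  satisfy \<open>f \<le> 0\<close>, which forces \<open>f(a\<^sub>i, b\<^sub>j, c\<^sub>k) \<le> - f(a\<^sub>0, b\<^sub>0, c\<^sub>0) / 10\<close>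
  unless \<open>a\<^sub>i + b\<^sub>j + c\<^sub>k\<close> is very small. Ten such triples suffice. If, on the other hand,
  \<open>a\<^sub>i + b\<^sub>j + c\<^sub>k\<close> is very small for one of them, then the three sequences have such short
  supports that \<open>A + B + C \<le> 15/8\<close>, and then \<open>f(A,B,C) \<le> 0\<close> is immediate.
\<close>

section \<open>Bounds for a symmetric function of three variables in the unit interval\<close>

definition excess :: "real \<Rightarrow> real \<Rightarrow> real \<Rightarrow> real" where
  "excess x y z = x * y + y * z + z * x - 5 / 8 * (x + y + z)"

lemma excess_rotate: "excess x y z = excess y z x"
  by (simp add: excess_def algebra_simps)

lemma excess_le_sum: "excess x y z \<le> (x + y + z) * ((x + y + z) / 3 - 5 / 8)"
proof -
  have "0 \<le> (x - y)\<^sup>2 + (y - z)\<^sup>2 + (z - x)\<^sup>2" by simp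
  then show ?thesis
    unfolding excess_def by (simp add: power2_eq_square algebra_simps)
qed

lemma excess_nonpos_of_sum_le:
  assumes "0 \<le> x" "0 \<le> y" "0 \<le> z" "x + y + z \<le> 15 / 8"
  shows "excess x y z \<le> 0"
proof -
  have "(x + y + z) * ((x + y + z) / 3 - 5 / 8) \<le> 0"
    using assms by (intro mult_nonneg_nonpos) auto
  then show ?thesis using excess_le_sum[of x y z] by linarith
qed

text \<open>Expansion around the corner \<open>(1, 1, 1)\<close>, where products of the complements
  are easy to bound on either side: they are nonnegative and at most either factor.\<close>

lemma excess_complement:
  "excess x y z = 9 / 8 - 11 / 8 * ((1 - x) + (1 - y) + (1 - z))
     + ((1 - x) * (1 - y) + (1 - y) * (1 - z) + (1 - z) * (1 - x))"
  by (simp add: excess_def field_simps)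

lemma excess_le:
  assumes "x \<in> {0..1}" "y \<in> {0..1}" "z \<in> {0..1}"
  shows "excess x y z \<le> 9 / 8"
proof -
  have "(1 - x) * (1 - y) \<le> 1 - x" "(1 - y) * (1 - z) \<le> 1 - y" "(1 - z) * (1 - x) \<le> 1 - z"
    using assms by (auto intro: mult_left_le)
  then show ?thesis
    using assms unfolding excess_complement[of x y z] atLeastAtMost_iff by argo
qed

lemma sum_le_of_excess_nonpos:
  assumes "x \<in> {0..1}" "y \<in> {0..1}" "z \<in> {0..1}" and "excess x y z \<le> 0"
  shows "x + y + z \<le> 24 / 11"
proof -
  have "0 \<le> (1 - x) * (1 - y)" "0 \<le> (1 - y) * (1 - z)" "0 \<le> (1 - z) * (1 - x)"
    using assms by auto
  then show ?thesis
    using assms(4) unfolding excess_complement[of x y z] by argo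
qed

text \<open>With \<open>s = y + z > 5 / 8\<close>, taking \<open>x = 1\<close> and
  \<open>y = z\<close> gives the upper bound \<open>s\<^sup>2 / 4 + 3 / 8 * s - 5 / 8\<close>, which
  is just below \<open>- (9 / 80)\<close> at \<open>s = 433 / 500\<close>.\<close>

lemma pair_sum_ge_of_excess:
  assumes "x \<le> 1" "0 \<le> y" "0 \<le> z" "x + y + z \<ge> 167 / 100" and "excess x y z \<ge> - (9 / 80)"
  shows "y + z \<ge> 433 / 500"
proof (rule ccontr)
  assume *: "\<not> y + z \<ge> 433 / 500"
  define s where "s = y + z"
  have s: "67 / 100 \<le> s" "s < 433 / 500" using assms * by (auto simp: s_def)
  have "4 * (y * z) \<le> s\<^sup>2"
    using zero_le_power2[of "y - z"] by (simp add: s_def power2_eq_square algebra_simps)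
  moreover have "x * (s - 5 / 8) \<le> 1 * (s - 5 / 8)"
    using assms s by (intro mult_right_mono) auto
  moreover have "excess x y z = x * (s - 5 / 8) + y * z - 5 / 8 * s"
    by (simp add: excess_def s_def algebra_simps)
  moreover have "s\<^sup>2 \<le> (433 / 500)\<^sup>2"
    using s by (intro power_mono) auto
  then have "s\<^sup>2 \<le> 187489 / 250000" by (simp add: power2_eq_square)
  ultimately show False using s assms(5) by argo
qed

text \<open>\<open>excess\<close> is affine in each variable, so the three raised points bound the
  first-order gains from \<open>(x, y, z)\<close> to \<open>(a, b, c)\<close> by
  \<open>- excess x y z\<close>. Since \<open>10 * (9 / 80) = 9 / 8\<close>, only values above
  \<open>- (9 / 80)\<close> need this argument.\<close>

lemma excess_compensates:
  assumes "x \<in> {0..a}" "y \<in> {0..b}" "z \<in> {0..c}" and "a \<le> 1" "b \<le> 1" "c \<le> 1"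
    and "excess a y z \<le> 0" "excess x b z \<le> 0" "excess x y c \<le> 0"
    and sum: "x + y + z \<ge> 21 / 100"
  shows "excess a b c \<le> - 10 * excess x y z"
proof (cases "excess x y z \<le> - (9 / 80)")
  case True
  have "excess a b c \<le> 9 / 8" using assms by (intro excess_le) auto
  with True show ?thesis by linarith
next
  case False
  define \<phi> where "\<phi> = - excess x y z"
  define p q r where "p = a - x" and "q = b - y" and "r = c - z"
  have \<phi>: "\<phi> < 9 / 80" using False by (simp add: \<phi>_def)
  have large: "x + y + z \<ge> 167 / 100"
  proof (rule ccontr)
    define e where "e = x + y + z"
    assume "\<not> x + y + z \<ge> 167 / 100"
    then have e: "21 / 100 \<le> e" "e < 167 / 100" using sum by (auto simp: e_def)
    \<comment> \<open>Chord bound: the convex function \<open>e * e / 3 - 5 / 8 * e\<close> is below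
      \<open>- (9 / 80)\<close> at both ends of the interval, hence on all of it.\<close>
    then have "0 \<le> (e - 21 / 100) * (167 / 100 - e)" by (intro mult_nonneg_nonneg) auto
    then have "e * e \<le> 188 / 100 * e - 3507 / 10000" by (simp add: field_simps)
    moreover have "excess x y z \<le> e * e / 3 - 5 / 8 * e"
      using excess_le_sum[of x y z, folded e_def] by (simp add: algebra_simps)
    ultimately show False using False e by argo
  qed
  have nonneg: "0 \<le> p" "0 \<le> q" "0 \<le> r" using assms by (auto simp: p_def q_def r_def)
  have "y + z \<ge> 433 / 500" "z + x \<ge> 433 / 500" "x + y \<ge> 433 / 500"
    using pair_sum_ge_of_excess[of x y z] pair_sum_ge_of_excess[of y z x]
      pair_sum_ge_of_excess[of z x y] excess_rotate[of x y z] excess_rotate[of y z x]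
      False large assms by auto
  \<comment> \<open>The slopes are at least \<open>433 / 500 - 5 / 8 = 241 / 1000\<close>.\<close>
  then have "p * (6 / 25) \<le> p * (y + z - 5 / 8)" "q * (6 / 25) \<le> q * (z + x - 5 / 8)"
    "r * (6 / 25) \<le> r * (x + y - 5 / 8)"
    using nonneg by (intro mult_left_mono; simp)+
  moreover have L: "p * (y + z - 5 / 8) \<le> \<phi>" "q * (z + x - 5 / 8) \<le> \<phi>" "r * (x + y - 5 / 8) \<le> \<phi>"
    using assms(7-9) by (simp_all add: excess_def \<phi>_def p_def q_def r_def field_simps)
  ultimately have pqr: "p \<le> 25 / 6 * \<phi>" "q \<le> 25 / 6 * \<phi>" "r \<le> 25 / 6 * \<phi>" by linarith+
  have small: "u * v \<le> 5 / 2 * \<phi>" if "0 \<le> u" "0 \<le> v" "u \<le> 25 / 6 * \<phi>" "v \<le> 25 / 6 * \<phi>" for u v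
  proof -
    have "u * v \<le> (25 / 6 * \<phi>) * (25 / 6 * \<phi>)" using that by (intro mult_mono) auto
    also have "\<dots> \<le> (25 / 6 * \<phi>) * (25 / 6 * (9 / 80))"
      using that \<phi> by (intro mult_left_mono) auto
    finally show ?thesis using that by simp
  qed
  \<comment> \<open>Exact expansion, ending at second order; the terms are at most
    \<open>(- 1 + 3 + 3 * (5 / 2)) * \<phi>\<close>, and \<phi> is nonnegative.\<close>
  have "excess a b c = - \<phi> + p * (y + z - 5 / 8) + q * (z + x - 5 / 8) + r * (x + y - 5 / 8)
      + p * q + q * r + r * p"
    by (simp add: excess_def \<phi>_def p_def q_def r_def field_simps)
  also have "\<dots> \<le> 10 * \<phi>"
    using L small[of p q] small[of q r] small[of r p] nonneg pqr by argo
  finally show ?thesis by (simp add: \<phi>_def)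
qed

section \<open>Summation over the Latin square\<close>

lemma sum_mod_reflect:
  fixes g :: "nat \<Rightarrow> 'a::comm_monoid_add"
  assumes "i < n"
  shows "(\<Sum>j<n. g ((2 * n - i - j) mod n)) = (\<Sum>k<n. g k)"
proof -
  \<comment> \<open>The reflection is an involution of the indices below \<open>n\<close>; starting
    from \<open>2 * n\<close> keeps the natural subtraction from truncating.\<close>
  have inv: "(2 * n - i - (2 * n - i - j) mod n) mod n = j" if "j < n" for j
  proof (cases "i + j = 0 \<or> i + j > n")
    case True
    then consider "i = 0" "j = 0" | "i + j > n" by auto
    then show ?thesis
    proof cases
      case 2
      then have "(2 * n - i - j) mod n = 2 * n - i - j" using assms that by simp
      then show ?thesis using that assms by simp
    qed (use assms in simp)
  next
    case False
    then have "2 * n - i - j = (n - i - j) + n" "n - i - j < n" using assms that by auto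
    then have "(2 * n - i - j) mod n = n - i - j" by (simp only: mod_add_self2 mod_less)
    then have "2 * n - i - (2 * n - i - j) mod n = j + n" using False assms by simp
    then show ?thesis using that by simp
  qed
  show ?thesis
    by (rule sum.reindex_bij_witness[where i = "\<lambda>k. (2 * n - i - k) mod n"
          and j = "\<lambda>j. (2 * n - i - j) mod n"]) (use assms inv in auto)
qed

text \<open>Each monomial involves at most two of the three indices, and any two of them run through
  all pairs exactly once.\<close>

lemma sum_excess_latin_square:
  fixes a b c :: "nat \<Rightarrow> real"
  assumes "n > 0"
  defines "A \<equiv> (\<Sum>i<n. a i) / n" and "B \<equiv> (\<Sum>i<n. b i) / n" and "C \<equiv> (\<Sum>i<n. c i) / n"
  shows "(\<Sum>i<n. \<Sum>j<n. excess (a i) (b j) (c ((2 * n - i - j) mod n))) = n\<^sup>2 * excess A B C"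
proof -
  define k where "k i j = (2 * n - i - j) mod n" for i j
  have k_commute: "k i j = k j i" for i j by (simp add: k_def add.commute)
  have c_row: "(\<Sum>j<n. c (k i j)) = n * C" if "i < n" for i
    using sum_mod_reflect[OF that, of c] assms by (simp add: k_def)
  have c_col: "(\<Sum>i<n. c (k i j)) = n * C" if "j < n" for j
    using c_row[OF that] by (simp add: k_commute)
  have a: "(\<Sum>i<n. a i) = n * A" and b: "(\<Sum>j<n. b j) = n * B" using assms by auto
  have ab: "(\<Sum>i<n. \<Sum>j<n. a i * b j) = n\<^sup>2 * (A * B)"
    by (simp add: sum_product[symmetric] a b power2_eq_square)
  have "(\<Sum>i<n. \<Sum>j<n. b j * c (k i j)) = (\<Sum>j<n. b j * (\<Sum>i<n. c (k i j)))"
    by (subst sum.swap) (simp add: sum_distrib_left)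
  also have "\<dots> = n\<^sup>2 * (B * C)"
    by (simp add: c_col sum_distrib_right[symmetric] b power2_eq_square)
  finally have bc: "(\<Sum>i<n. \<Sum>j<n. b j * c (k i j)) = n\<^sup>2 * (B * C)" .
  have ca: "(\<Sum>i<n. \<Sum>j<n. c (k i j) * a i) = n\<^sup>2 * (C * A)"
    by (simp add: sum_distrib_right[symmetric] c_row sum_distrib_left[symmetric] a power2_eq_square)
  have lin: "(\<Sum>i<n. \<Sum>j<n. a i + b j + c (k i j)) = n\<^sup>2 * (A + B + C)"
    by (simp add: sum.distrib a b c_row sum_distrib_left[symmetric] power2_eq_square algebra_simps)
  have linear: "(\<Sum>i<n. \<Sum>j<n. P i j - 5 / 8 * Q i j)
      = (\<Sum>i<n. \<Sum>j<n. P i j) - 5 / 8 * (\<Sum>i<n. \<Sum>j<n. Q i j)" for P Q :: "nat \<Rightarrow> nat \<Rightarrow> real"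
    by (simp only: sum_subtractf sum_distrib_left)
  have "(\<Sum>i<n. \<Sum>j<n. excess (a i) (b j) (c (k i j)))
      = (\<Sum>i<n. \<Sum>j<n. a i * b j) + (\<Sum>i<n. \<Sum>j<n. b j * c (k i j))
        + (\<Sum>i<n. \<Sum>j<n. c (k i j) * a i) - 5 / 8 * (\<Sum>i<n. \<Sum>j<n. a i + b j + c (k i j))"
    unfolding excess_def linear by (simp only: sum.distrib)
  also have "\<dots> = n\<^sup>2 * excess A B C"
    unfolding ab bc ca lin by (simp add: excess_def algebra_simps)
  finally show ?thesis by (simp add: k_def)
qed

section \<open>Bounding the averages when one triple is very small\<close>

lemma sum_split_three:
  fixes f :: "nat \<Rightarrow> real"
  assumes "M \<le> i" "i \<le> n"
  shows "(\<Sum>t<n. f t) = (\<Sum>t<i - M. f t) + (\<Sum>t<M. f (i - M + t)) + (\<Sum>t=i..<n. f t)"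
proof -
  have "(\<Sum>t<n. f t) = (\<Sum>t=0..<i - M. f t) + (\<Sum>t=i - M..<i. f t) + (\<Sum>t=i..<n. f t)"
    using assms by (simp add: sum.atLeastLessThan_concat lessThan_atLeast0)
  moreover have "(\<Sum>t=i - M..<i. f t) = (\<Sum>t<M. f (i - M + t))"
    using sum.shift_bounds_nat_ivl[of f 0 "i - M" M] assms
    by (simp add: lessThan_atLeast0 add.commute)
  ultimately show ?thesis by (simp add: lessThan_atLeast0)
qed

lemma sum_le_split:
  fixes f :: "nat \<Rightarrow> real"
  assumes "antimono_on {0..<n} f" "\<forall>t\<in>{0..<n}. f t \<in> {0..1}" "M \<le> i" "i < n"
  shows "(\<Sum>t<n. f t) \<le> (real i - real M) + (\<Sum>t<M. f (i - M + t)) + (real n - real M) * f i"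
proof -
  have "(\<Sum>t<i - M. f t) \<le> (\<Sum>t<i - M. 1)"
    using assms by (intro sum_mono) auto
  moreover have "(\<Sum>t=i..<n. f t) \<le> (\<Sum>t=i..<n. f i)"
    using assms by (intro sum_mono) (auto simp: monotone_on_def)
  \<comment> \<open>The tail length is enlarged so that the three sequences later share one
    factor.\<close>
  moreover have "(real n - real i) * f i \<le> (real n - real M) * f i"
    using assms by (intro mult_right_mono) auto
  ultimately show ?thesis
    using assms by (simp add: sum_split_three[OF assms(3), of n f] of_nat_diff)
qed

lemma sum_le_of_small_triple:
  fixes a b c :: "nat \<Rightarrow> real"
  assumes mono: "antimono_on {0..<n} a" "antimono_on {0..<n} b" "antimono_on {0..<n} c"
    and range: "\<forall>i\<in>{0..<n}. a i \<in> {0..1}" "\<forall>i\<in>{0..<n}. b i \<in> {0..1}" "\<forall>i\<in>{0..<n}. c i \<in> {0..1}"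
    and nonpos: "\<And>i j k. i < n \<Longrightarrow> j < n \<Longrightarrow> k < n \<Longrightarrow> n \<le> i + j + k \<Longrightarrow> excess (a i) (b j) (c k) \<le> 0"
    and M: "n \<le> 3 * M" "2 * M < n"
    and ijk: "i \<in> {M..<n}" "j \<in> {M..<n}" "k \<in> {M..<n}" "i + j + k = 2 * n"
    and small: "a i + b j + c k \<le> 21 / 100"
  shows "(\<Sum>t<n. a t) + (\<Sum>t<n. b t) + (\<Sum>t<n. c t) \<le> 15 / 8 * n"
proof -
  define Mid where "Mid = (\<Sum>t<M. a (i - M + t)) + (\<Sum>t<M. b (j - M + t)) + (\<Sum>t<M. c (k - M + t))"
  \<comment> \<open>Reversing the window of \<open>b\<close> makes the indices
    \<open>i - M + t\<close>, \<open>j - Suc t\<close>, \<open>k - M\<close> sum to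
    \<open>2 * n - 2 * M - 1\<close>, which is at least \<open>n\<close>.\<close>
  have "(\<Sum>t<M. b (j - M + t)) = (\<Sum>t<M. b (j - Suc t))"
    using ijk by (subst sum.nat_diff_reindex[symmetric]) (auto intro!: sum.cong arg_cong[of _ _ b])
  then have "Mid = (\<Sum>t<M. a (i - M + t) + b (j - Suc t) + c (k - M + t))"
    by (simp add: Mid_def sum.distrib)
  also have "\<dots> \<le> (\<Sum>t<M. 24 / 11)"
  proof (rule sum_mono)
    fix t assume t: "t \<in> {..<M}"
    have "a (i - M + t) + b (j - Suc t) + c (k - M) \<le> 24 / 11"
      using t ijk M range by (intro sum_le_of_excess_nonpos nonpos) auto
    moreover have "c (k - M + t) \<le> c (k - M)"
      using mono(3) t ijk by (auto simp: monotone_on_def)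
    ultimately show "a (i - M + t) + b (j - Suc t) + c (k - M + t) \<le> 24 / 11" by linarith
  qed
  finally have Mid: "Mid \<le> M * (24 / 11)" by simp
  have "(real n - real M) * (a i + b j + c k) \<le> (real n - real M) * (21 / 100)"
    using small M by (intro mult_left_mono) auto
  then have "(real n - real M) * a i + (real n - real M) * b j + (real n - real M) * c k
      \<le> (real n - real M) * (21 / 100)"
    by (simp add: distrib_left)
  moreover have "(\<Sum>t<n. a t) + (\<Sum>t<n. b t) + (\<Sum>t<n. c t)
      \<le> (real i + real j + real k) - 3 * real M + Mid
        + ((real n - real M) * a i + (real n - real M) * b j + (real n - real M) * c k)"
    using sum_le_split[OF mono(1) range(1), of M i] sum_le_split[OF mono(2) range(2), of M j]
      sum_le_split[OF mono(3) range(3), of M k] ijk by (simp add: Mid_def)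
  moreover have "real i + real j + real k = 2 * real n" "real n \<le> 3 * real M"
    using ijk M by linarith+
  \<comment> \<open>The total is at most
    \<open>2 * n - 3 * M + 24 / 11 * M + 21 / 100 * (n - M)\<close>; this decreases in
    \<open>M\<close>, and \<open>M = n / 3\<close> gives less than \<open>1.87 * n\<close>.\<close>
  ultimately show ?thesis using Mid by (simp add: algebra_simps)
qed

section \<open>Compensating the one uncovered triple\<close>

lemma latin_square_index_sum:
  fixes i j n :: nat
  assumes "i < n" "j < n" "(i, j) \<noteq> (0, 0)"
  shows "n \<le> i + j + (2 * n - i - j) mod n"
proof (cases "i + j < n")
  case True
  then have "2 * n - i - j = (n - i - j) + n" "n - i - j < n" using assms by auto
  then have "(2 * n - i - j) mod n = n - i - j" by (simp only: mod_add_self2 mod_less)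
  then show ?thesis using True by simp
qed simp

text \<open>Each element of \<open>T\<close> absorbs an equal share
  \<open>g z / card T\<close>.\<close>

lemma sum_le_by_compensation:
  fixes g :: "'a \<Rightarrow> real"
  assumes "finite S" "z \<in> S" "T \<subseteq> S - {z}"
    and "\<And>s. s \<in> S - {z} \<Longrightarrow> g s \<le> 0"
    and "\<And>t. t \<in> T \<Longrightarrow> g z \<le> - card T * g t"
    and "T \<noteq> {}"
  shows "sum g S \<le> 0"
proof -
  have T: "finite T" using assms finite_subset by blast
  then have card: "real (card T) > 0" using assms(6) by (simp add: card_gt_0_iff)
  have "sum g S = g z + sum g (S - {z})" using assms by (simp add: sum.remove)
  also have "sum g (S - {z}) = sum g T + sum g (S - {z} - T)"
    using assms by (subst sum.subset_diff[of T]) auto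
  also have "sum g (S - {z} - T) \<le> 0" using assms by (intro sum_nonpos) auto
  also have "sum g T \<le> (\<Sum>t\<in>T. - g z / card T)"
    using assms(5) card by (intro sum_mono) (fastforce simp: field_simps)
  also have "\<dots> = - g z" using card by simp
  finally show ?thesis by simp
qed

text \<open>The ten triples are \<open>(M + u + v, J - u, K - v)\<close> with \<open>u + v \<le> 3\<close>.\<close>

lemma compensating_indices:
  fixes n :: nat
  assumes "6 \<le> n" "even n"
  obtains M J K where "n \<le> 3 * M" "2 * M < n" "M + J + K = 2 * n" "M + 3 < n"
    "J \<in> {M + 3..<n}" "K \<in> {M + 3..<n}"
proof (cases "n = 6")
  case True
  then show ?thesis by (intro that[of 2 5 5]) auto
next
  case False
  \<comment> \<open>Evenness enters here: it excludes \<open>n = 7\<close>, where no such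
    \<open>M\<close>, \<open>J\<close>, \<open>K\<close> exist.\<close>
  then have n: "8 \<le> n" using assms by presburger
  \<comment> \<open>\<open>M\<close> is \<open>n / 3\<close> rounded up, and the other two indices
    share the rest as equally as possible.\<close>
  define M where "M = (n + 2) div 3"
  define J where "J = (2 * n - M) div 2"
  have M: "n \<le> 3 * M" "3 * M \<le> n + 2" by (simp_all add: M_def)
  then have J: "2 * J + M \<le> 2 * n" "2 * n \<le> 2 * J + M + 1" by (auto simp: J_def)
  show ?thesis
  proof
    show "n \<le> 3 * M" "2 * M < n" "M + 3 < n" "M + J + (2 * n - M - J) = 2 * n"
      using n M J by linarith+
    show "J \<in> {M + 3..<n}" "2 * n - M - J \<in> {M + 3..<n}"
      using n M J by auto
  qed
qed

theorem theorem1p2: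
  fixes n :: nat and a b c :: "nat \<Rightarrow> real" and A B C :: real
  assumes "n \<ge> 6" and "even n"
    and "antimono_on {0..<n} a" and "antimono_on {0..<n} b" and "antimono_on {0..<n} c"
    and "\<forall>i\<in>{0..<n}. a i \<in> {0..1}" and "\<forall>i\<in>{0..<n}. b i \<in> {0..1}" and "\<forall>i\<in>{0..<n}. c i \<in> {0..1}"
    and "A = 1 / real n * (\<Sum>i=0..<n. a i)"
    and "B = 1 / real n * (\<Sum>i=0..<n. b i)"
    and "C = 1 / real n * (\<Sum>i=0..<n. c i)"
    and "\<forall>i\<in>{0..<n}. \<forall>j\<in>{0..<n}. \<forall>k\<in>{0..<n}. i + j + k \<ge> n \<longrightarrow>
           a i * b j + b j * c k + c k * a i \<le> 5 / 8 * (a i + b j + c k)"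
  shows "A * B + B * C + C * A \<le> 5 / 8 * (A + B + C)"
proof -
  note mono = assms(3-5) and range = assms(6-8)
  have ABC: "A = (\<Sum>i<n. a i) / n" "B = (\<Sum>i<n. b i) / n" "C = (\<Sum>i<n. c i) / n"
    using assms(9-11) by (simp_all add: lessThan_atLeast0)
  have nonpos: "excess (a i) (b j) (c k) \<le> 0"
    if "i < n" "j < n" "k < n" "n \<le> i + j + k" for i j k
    using assms(12) that by (simp add: excess_def)
  obtain M J K where M: "n \<le> 3 * M" "2 * M < n" "M + 3 < n"
    and JK: "M + J + K = 2 * n" "J \<in> {M + 3..<n}" "K \<in> {M + 3..<n}"
    using compensating_indices[OF assms(1,2)] by metis
  define g where "g = (\<lambda>(i, j). excess (a i) (b j) (c ((2 * n - i - j) mod n)))"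
  define D :: "(nat \<times> nat) set" where
    "D = {(0,0), (0,1), (0,2), (0,3), (1,0), (1,1), (1,2), (2,0), (2,1), (3,0)}"
  \<comment> \<open>Only the first two indices are recorded; the Latin square forces the third to be
    \<open>K - v\<close>.\<close>
  define T where "T = (\<lambda>(u, v). (M + u + v, J - u)) ` D"
  have D: "u + v \<le> 3" if "(u, v) \<in> D" for u v using that by (auto simp: D_def)
  have "inj_on (\<lambda>(u, v). (M + u + v, J - u)) D"
    using D JK by (fastforce simp: inj_on_def)
  then have "card T = card D" unfolding T_def by (rule card_image)
  then have card_T: "card T = 10" by (simp add: D_def)
  have "excess A B C \<le> 0"
  proof (cases "\<exists>i j k. i \<in> {M..<n} \<and> j \<in> {M..<n} \<and> k \<in> {M..<n} \<and> i + j + k = 2 * n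
      \<and> a i + b j + c k \<le> 21 / 100")
    case True
    then have "(\<Sum>t<n. a t) + (\<Sum>t<n. b t) + (\<Sum>t<n. c t) \<le> 15 / 8 * n"
      using sum_le_of_small_triple[OF mono range nonpos M(1,2)] by blast
    then have "A + B + C \<le> 15 / 8"
      using assms(1) by (simp add: ABC add_divide_distrib[symmetric] divide_le_eq)
    moreover have "0 \<le> A" "0 \<le> B" "0 \<le> C"
      using range by (auto simp: ABC intro!: divide_nonneg_nonneg sum_nonneg)
    ultimately show ?thesis by (intro excess_nonpos_of_sum_le)
  next
    case False
    have "sum g ({..<n} \<times> {..<n}) \<le> 0"
    proof (rule sum_le_by_compensation[where z = "(0, 0)" and T = T])
      show "T \<subseteq> {..<n} \<times> {..<n} - {(0, 0)}"
        using D M JK by (fastforce simp: T_def)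
      show "g s \<le> 0" if "s \<in> {..<n} \<times> {..<n} - {(0, 0)}" for s
        using that latin_square_index_sum[of "fst s" n "snd s"]
        by (auto simp: g_def split: prod.splits intro!: nonpos)
      show "g (0, 0) \<le> - card T * g t" if "t \<in> T" for t
      proof -
        obtain u v where "u + v \<le> 3" and t: "t = (M + u + v, J - u)"
          using \<open>t \<in> T\<close> D by (auto simp: T_def)
        define i j k where "i = M + u + v" and "j = J - u" and "k = K - v"
        have ijk: "i \<in> {M..<n}" "j \<in> {M..<n}" "k \<in> {M..<n}" "i + j + k = 2 * n"
          using \<open>u + v \<le> 3\<close> M JK by (auto simp: i_def j_def k_def)
        then have "2 * n - i - j = k" by linarith
        then have g_t: "g t = excess (a i) (b j) (c k)"
          using ijk by (simp add: g_def t i_def[symmetric] j_def[symmetric])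
        have "excess (a 0) (b 0) (c 0) \<le> - 10 * excess (a i) (b j) (c k)"
        proof (rule excess_compensates)
          show "a i \<in> {0..a 0}" "b j \<in> {0..b 0}" "c k \<in> {0..c 0}"
            using mono range ijk by (auto simp: monotone_on_def)
          show "a 0 \<le> 1" "b 0 \<le> 1" "c 0 \<le> 1" using range assms(1) by auto
          \<comment> \<open>Setting one index to 0 leaves an index sum above \<open>n\<close>,
            because the full sum is \<open>2 * n\<close> and each index is below
            \<open>n\<close>.\<close>
          show "excess (a 0) (b j) (c k) \<le> 0" "excess (a i) (b 0) (c k) \<le> 0"
            "excess (a i) (b j) (c 0) \<le> 0"
            using ijk by (auto intro!: nonpos)
          show "21 / 100 \<le> a i + b j + c k" using False ijk by force
        qed
        then show ?thesis by (simp add: card_T g_t) (simp add: g_def)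
      qed
      show "T \<noteq> {}" using card_T by auto
    qed (use assms(1) in auto)
    moreover have "sum g ({..<n} \<times> {..<n}) = n\<^sup>2 * excess A B C"
      using sum_excess_latin_square[of n a b c] assms(1)
      by (simp add: g_def sum.cartesian_product[symmetric] ABC)
    ultimately show ?thesis using assms(1) by (simp add: mult_le_0_iff)
  qed
  then show ?thesis by (simp add: excess_def)
qed

end
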